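(* Let $\mathbf P=(P,\le,0,{}^* )$ be a pseudocomplemented poset and let $f$ be an order-automorphism of $\mathbf P$. Assume that for all $a,b\in P$, $\big(f^{-1}(b^* )\big)^*\le a^*$ implies $a\le f^{-1}(b^* )$. Define $g\colon P\to P$ by $g(x):=\big(f^{-1}(x^* )\big)^*$ for all $x\in P$, and assume that for all $a,b\in P$, $g(b)\le a$ is equivalent to $g(b)\le a^{**}$. Then $g$ is the unique mapping from $P$ to $P$ that is orthogonally adjoint to $f$.
   Context: Let $(P,\le,0)$ be a poset with least element $0$. For $x,y\in P$, $x\wedge y=0$ means that the infimum of $x,y$ exists and equals $0$ (i.e. $0$ is the only common lower bound of $x$ and $y$). Put $a^\perp:=\{x\in P\mid x\wedge a=0\}$. The poset is pseudocomplemented if for each $a\in P$ the set $a^\perp$ has a greatest element, denoted $a^*$. An order-automorphism of $(P,\le)$ is a bijection $f\colon P\to P$ such that $x\le y$ if and only if $f(x)\le f(y)$ for all $x,y\in P$; $f^{-1}$ denotes its inverse map. Mappings $f,g\colon P\to P$ are orthogonally adjoint if for all $x,y\in P$: $f(x)\wedge y=0$ if and only if $x\wedge g(y)=0$. *)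

theory Defs
  imports "HOL-Library.Lub_Glb"
begin

(* The infimum of x and y exists and equals the least element. *)
definition meet_bot :: "'a::order_bot \<Rightarrow> 'a \<Rightarrow> bool" where
  "meet_bot x y \<longleftrightarrow> isGlb UNIV {x, y} bot"

definition perp :: "'a::order_bot \<Rightarrow> 'a set" where
  "perp a = {x. meet_bot x a}"

definition pseudocomplemented :: "'a::order_bot itself \<Rightarrow> bool" where
  "pseudocomplemented _ \<longleftrightarrow> (\<forall>a::'a. \<exists>z \<in> perp a. \<forall>x \<in> perp a. x \<le> z)"

(* Meaningful only when perp a has a greatest element; otherwise unspecified. *)
definition pcompl :: "'a::order_bot \<Rightarrow> 'a" where
  "pcompl a = (GREATEST x. x \<in> perp a)"

definition order_automorphism :: "('a::order \<Rightarrow> 'a) \<Rightarrow> bool" where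
  "order_automorphism f \<longleftrightarrow> bij f \<and> (\<forall>x y. x \<le> y \<longleftrightarrow> f x \<le> f y)"

definition orthogonally_adjoint :: "('a::order_bot \<Rightarrow> 'a) \<Rightarrow> ('a \<Rightarrow> 'a) \<Rightarrow> bool" where
  "orthogonally_adjoint f g \<longleftrightarrow> (\<forall>x y. meet_bot (f x) y \<longleftrightarrow> meet_bot x (g y))"

end

(* Write x' for the pseudocomplement of x. Two elements x and y meet in 0 iff x <= y', so
   adjointness of f and g says that f^-1 y' = (g y)', that is, f^-1 y' is closed under double
   pseudocomplementation; the first hypothesis gives this. Any other adjoint h satisfies
   (h y)' = (g y)'. Hence h y <= (g y)'' = g y because g y is a pseudocomplement, and
   g y <= (h y)'' yields g y <= h y by the second hypothesis. *)
theory Submission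
  imports Defs
begin

lemma meet_bot_iff: "meet_bot x y \<longleftrightarrow> (\<forall>z. z \<le> x \<and> z \<le> y \<longrightarrow> z = bot)"
  unfolding meet_bot_def isGlb_def isLb_def greatestP_def setle_def setge_def
  by (auto simp: bot_unique)

lemma meet_bot_commute: "meet_bot x y \<longleftrightarrow> meet_bot y x"
  unfolding meet_bot_iff by blast

lemma meet_bot_mono: "meet_bot y z \<Longrightarrow> x \<le> y \<Longrightarrow> meet_bot x z"
  unfolding meet_bot_iff by (meson order_trans)

text \<open>\<open>perp y\<close> is a down-set by \<open>meet_bot_mono\<close>, so its greatest
  element generates it as a principal ideal.\<close>

lemma meet_bot_iff_le_pcompl:
  fixes x y :: "'a::order_bot"
  assumes "pseudocomplemented TYPE('a)"
  shows "meet_bot x y \<longleftrightarrow> x \<le> pcompl y"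
proof -
  obtain z where z: "z \<in> perp y" "\<And>x. x \<in> perp y \<Longrightarrow> x \<le> z"
    using assms unfolding pseudocomplemented_def by blast
  then have "pcompl y = z"
    unfolding pcompl_def by (intro Greatest_equality) auto
  with z show ?thesis
    unfolding perp_def using meet_bot_mono by blast
qed

text \<open>Symmetry of \<open>meet_bot\<close> makes \<open>pcompl\<close> an antitone Galois
  connection of the poset with itself.\<close>

lemma le_pcompl_commute:
  fixes x y :: "'a::order_bot"
  assumes "pseudocomplemented TYPE('a)"
  shows "x \<le> pcompl y \<longleftrightarrow> y \<le> pcompl x"
  using meet_bot_commute meet_bot_iff_le_pcompl[OF assms] by metis

lemma le_pcompl_pcompl:
  fixes x :: "'a::order_bot"
  assumes "pseudocomplemented TYPE('a)"
  shows "x \<le> pcompl (pcompl x)"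
  using le_pcompl_commute[OF assms] by blast

lemma pcompl_pcompl_pcompl:
  fixes x :: "'a::order_bot"
  assumes "pseudocomplemented TYPE('a)"
  shows "pcompl (pcompl (pcompl x)) = pcompl x"
proof (rule order_antisym)
  \<comment> \<open>By \<open>le_pcompl_commute\<close> it suffices that \<open>x\<close> lies below
    its fourfold pseudocomplement.\<close>
  show "pcompl (pcompl (pcompl x)) \<le> pcompl x"
    using le_pcompl_commute[OF assms] le_pcompl_pcompl[OF assms] order_trans by metis
qed (rule le_pcompl_pcompl[OF assms])

lemma order_automorphism_le_iff:
  assumes "order_automorphism f"
  shows "f x \<le> y \<longleftrightarrow> x \<le> inv f y"
  using assms unfolding order_automorphism_def
  by (metis bij_inv_eq_iff)

theorem theorem19:
  fixes f g :: "'a::order_bot \<Rightarrow> 'a"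
  assumes "pseudocomplemented TYPE('a)"
    and "order_automorphism f"
    and "\<forall>a b. pcompl (inv f (pcompl b)) \<le> pcompl a \<longrightarrow> a \<le> inv f (pcompl b)"
    and "\<forall>x. g x = pcompl (inv f (pcompl x))"
    and "\<forall>a b. g b \<le> a \<longleftrightarrow> g b \<le> pcompl (pcompl a)"
  shows "orthogonally_adjoint f g \<and> (\<forall>h. orthogonally_adjoint f h \<longrightarrow> h = g)"
proof -
  note meet = meet_bot_iff_le_pcompl[OF assms(1)]
  \<comment> \<open>For \<le>, take \<open>a = pcompl (g y)\<close> and \<open>b = y\<close> in
    \<open>assms(3)\<close>: the premise becomes \<open>g y \<le> pcompl (pcompl (g y))\<close>. The
    converse is \<open>le_pcompl_pcompl\<close> at \<open>inv f (pcompl y)\<close>.\<close>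
  have "pcompl (g y) = inv f (pcompl y)" for y
    using assms(3,4) le_pcompl_pcompl[OF assms(1)] by (auto intro: order_antisym)
  then have adj: "orthogonally_adjoint f g"
    unfolding orthogonally_adjoint_def meet
    using order_automorphism_le_iff[OF assms(2)] by simp
  have "h = g" if h: "orthogonally_adjoint f h" for h
  proof (rule ext, rule order_antisym)
    fix y
    \<comment> \<open>Both sides are equivalent to \<open>f x \<le> pcompl y\<close>.\<close>
    have "x \<le> pcompl (h y) \<longleftrightarrow> x \<le> pcompl (g y)" for x
      using h adj unfolding orthogonally_adjoint_def meet by simp
    then have eq: "pcompl (h y) = pcompl (g y)"
      by (meson order_antisym order_refl)
    show "h y \<le> g y"
      using le_pcompl_pcompl[OF assms(1), of "h y"] pcompl_pcompl_pcompl[OF assms(1)] assms(4)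
      by (simp add: eq)
    show "g y \<le> h y"
      using le_pcompl_pcompl[OF assms(1), of "g y"] assms(5) by (metis eq)
  qed
  with adj show ?thesis by blast
qed

end
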